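(* Let $n$ and $t$ be positive integers with $t<n$, let $q$ be a prime power, and let $r = n \bmod t$. If $t > \frac{q^r-1}{q-1}$, then \[\mu_q(n,t) = \frac{q^n - q^{t+r}}{q^t-1} + 1.\]
   Context: ${\rm PG}(n-1,q)$ denotes the $(n-1)$-dimensional projective space over the finite field $\mathbb{F}_q$. A partial $(t-1)$-spread of ${\rm PG}(n-1,q)$ is a set of $(t-1)$-dimensional (projective) subspaces of ${\rm PG}(n-1,q)$ that are pairwise disjoint (equivalently, a set of $t$-dimensional subspaces of the vector space $\mathbb{F}_q^n$ pairwise intersecting only in the zero vector). $\mu_q(n,t)$ denotes the maximum size (cardinality) of a partial $(t-1)$-spread of ${\rm PG}(n-1,q)$. *)

theory Defs
  imports "HOL-Analysis.Analysis"
begin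

text \<open>
  The vector space \<open>\<F>\<^sub>q\<^sup>n\<close> is \<^typ>\<open>'a ^ 'n\<close> for a finite field \<^typ>\<open>'a\<close> with \<open>CARD('a) = q\<close> and a
  finite index type with \<open>CARD('n) = n\<close>; \<open>vec.subspace\<close> and \<open>vec.dim\<close> are linear subspaces and
  dimension over \<^typ>\<open>'a\<close>. The points of \<open>PG(n - 1, q)\<close> are the one-dimensional linear subspaces,
  and projective subspaces are regarded as sets of points.
\<close>

definition pg_points :: "('a::field ^ 'n) set set" where
  "pg_points = {P. vec.subspace P \<and> vec.dim P = 1}"

definition pg_subspaces :: "nat \<Rightarrow> ('a::field ^ 'n) set set set" where
  "pg_subspaces d = {{P \<in> pg_points. P \<subseteq> U} | U. vec.subspace U \<and> vec.dim U = d + 1}"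

definition partial_spread :: "nat \<Rightarrow> ('a::field ^ 'n) set set set \<Rightarrow> bool" where
  "partial_spread d S \<longleftrightarrow> S \<subseteq> pg_subspaces d \<and> pairwise disjnt S"

text \<open>
  \<open>\<mu>\<^sub>q(n, t)\<close>, with \<open>q\<close> and \<open>n\<close> carried by the type argument. Only meaningful for \<open>t \<ge> 1\<close>, because
  \<open>t - 1\<close> is truncated subtraction.
\<close>

definition max_partial_spread :: "('a::{field,finite} ^ 'n) itself \<Rightarrow> nat \<Rightarrow> nat" where
  "max_partial_spread _ t =
     Max (card ` {S :: ('a ^ 'n) set set set. partial_spread (t - 1) S})"

lemma partial_spread_cards_finite:
  "finite (card ` {S :: ('a::{field,finite} ^ 'n) set set set. partial_spread d S})"
  by simp

lemma partial_spread_cards_nonempty: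
  "card ` {S :: ('a::{field,finite} ^ 'n) set set set. partial_spread d S} \<noteq> {}"
  using partial_spread_def[of d "{}"] by auto

end

theory Submission
  imports "HOL-Algebra.Algebraic_Closure_Type" Defs
begin

text \<open>
  For the lower bound, split off a \<open>t\<close>-dimensional summand \<open>B\<close> of the space, with complement \<open>A\<close> of
  dimension \<open>s \<ge> t\<close>. Multiplications in the field of order \<open>q\<^sup>s\<close> give \<open>q\<^sup>s\<close> linear maps \<open>B \<rightarrow> A\<close> with
  injective differences; their graphs meet each other and \<open>A\<close> trivially, and one recurses in \<open>A\<close>
  until its dimension is \<open>t + r\<close>.

  For the upper bound, suppose there is one subspace more, and count the holes, i.e. the nonzero
  vectors not covered. Their number \<open>h\<close> in a subspace of codimension \<open>i \<le> t\<close> is such that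
  \<open>h + q\<^bsup>t-i\<^esup> - 1\<close> is a multiple \<open>m\<^sub>i (q - 1) q\<^bsup>t-i\<^esup>\<close>, where \<open>m\<^sub>0 = (q\<^sup>r - 1) / (q - 1) < t\<close> and \<open>m\<^sub>i > 0\<close>
  as long as \<open>i < t\<close>. By averaging, some hyperplane of the subspace contains at most \<open>h / q\<close> holes,
  which forces \<open>m\<^sub>i\<^sub>+\<^sub>1 < m\<^sub>i\<close>. Iterating \<open>m\<^sub>0\<close> times gives a contradiction.
\<close>

section \<open>Linear algebra over finite fields\<close>

lemma CARD_field_ge_2: "2 \<le> CARD('a::{field,finite})"
proof -
  have "card {0, 1 :: 'a} \<le> CARD('a)"
    by (rule card_mono) auto
  then show ?thesis by simp
qed

text \<open>Each further basis vector multiplies the size by \<open>CARD('a)\<close>, because the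
  coefficient of \<open>b\<close> is unique. The abstract locale covers both \<open>'a ^ 'n\<close>
  and subspaces of the algebraic closure.\<close>

lemma (in vector_space) card_span_independent:
  assumes "finite (UNIV :: 'a set)" "finite B" "independent B"
  shows "finite (span B) \<and> card (span B) = CARD('a) ^ card B"
  using assms(2,3)
proof (induction B rule: finite_induct)
  case empty
  then show ?case by simp
next
  case (insert b B)
  have ind: "independent B" and b: "b \<notin> span B"
    using insert.prems insert.hyps by (auto simp: independent_insert)
  let ?f = "\<lambda>(c, v). scale c b + v"
  have "span (insert b B) = ?f ` (UNIV \<times> span B)"
  proof (intro equalityI subsetI)
    fix x assume "x \<in> span (insert b B)"
    then obtain c where "x - scale c b \<in> span B"
      by (auto simp: span_insert)
    then show "x \<in> ?f ` (UNIV \<times> span B)"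
      by (intro image_eqI[of _ _ "(c, x - scale c b)"]) auto
  next
    fix x assume "x \<in> ?f ` (UNIV \<times> span B)"
    then obtain c v where "x = scale c b + v" "v \<in> span B" by auto
    then have "x - scale c b \<in> span B" by simp
    then show "x \<in> span (insert b B)"
      unfolding span_insert by blast
  qed
  moreover have "inj_on ?f (UNIV \<times> span B)"
  proof (rule inj_onI, clarify)
    fix c v d w assume v: "v \<in> span B" "w \<in> span B" and eq: "scale c b + v = scale d b + w"
    have "scale (c - d) b = w - v"
      using eq by (simp add: scale_left_diff_distrib algebra_simps)
    then have "scale (c - d) b \<in> span B"
      using v by (simp add: span_diff)
    then have "c = d"
      using b span_scale[of "scale (c - d) b" B "inverse (c - d)"] by (cases "c = d") auto
    then show "c = d \<and> v = w" using eq by simp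
  qed
  ultimately show ?case
    using insert assms(1) ind by (simp add: card_image card_cartesian_product)
qed

lemma (in vector_space) finite_subspace_basis:
  assumes "finite (UNIV :: 'a set)" "finite V" "subspace V"
  obtains B where "finite B" "independent B" "span B = V" "card V = CARD('a) ^ card B"
proof -
  obtain B where B: "B \<subseteq> V" "independent B" "V \<subseteq> span B"
    by (rule basis_exists[of V])
  have "finite B" using B assms(2) finite_subset by blast
  moreover have "span B = V"
    using B assms(3) span_minimal by blast
  ultimately show ?thesis
    using that card_span_independent[OF assms(1)] B by metis
qed

text \<open>An injection between bases extends linearly and stays injective on the span, since it
  sends the basis to an independent set.\<close>

lemma (in vector_space_pair) exists_linear_inj_on_span:
  assumes "finite B" "vs1.independent B" "finite C" "vs2.independent C" "card B \<le> card C"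
  obtains f where "Vector_Spaces.linear s1 s2 f" "inj_on f (vs1.span B)" "f ` vs1.span B \<subseteq> vs2.span C"
proof -
  obtain g where g: "g ` B \<subseteq> C" "inj_on g B"
    using card_le_inj[OF assms(1,3,5)] by auto
  obtain f where f: "Vector_Spaces.linear s1 s2 f" "\<forall>x\<in>B. f x = g x"
    using linear_independent_extend[OF assms(2)] by blast
  interpret f: Vector_Spaces.linear s1 s2 f by fact
  have img: "f ` B = g ` B" using f(2) by auto
  have "inj_on f (vs1.span B)"
  proof (rule f.inj_on_span_independent_image)
    show "vs2.independent (f ` B)"
      using assms(4) g(1) vs2.independent_mono img by metis
    show "inj_on f B"
      using g(2) f(2) by (simp add: inj_on_def)
  qed
  moreover have "f ` vs1.span B \<subseteq> vs2.span C"
    using f.span_image[of B] img g(1) vs2.span_mono by metis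
  ultimately show ?thesis using that f(1) by blast
qed

lemma card_vec_subspace:
  fixes U :: "('a::{field,finite} ^ 'n) set"
  assumes "vec.subspace U"
  shows "card U = CARD('a) ^ vec.dim U"
proof -
  obtain B where B: "finite B" "vec.independent B" "vec.span B = U" "card U = CARD('a) ^ card B"
    using vec.finite_subspace_basis[OF _ _ assms] by (metis finite)
  then show ?thesis
    by (metis vec.dim_span_eq_card_independent)
qed

lemma vec_subspace_inter_nontrivial:
  fixes S :: "('a::field ^ 'n) set"
  assumes "vec.dim S > 0" "S \<subseteq> Y" "S \<subseteq> Z"
  shows "Y \<inter> Z \<noteq> {0}"
proof
  assume "Y \<inter> Z = {0}"
  then have "S \<subseteq> {0}" using assms by blast
  then have "vec.dim S = 0" by (simp add: vec.dim_eq_0)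
  then show False using assms(1) by linarith
qed

lemma vec_subspace_split:
  fixes U :: "('a::field ^ 'n) set"
  assumes "vec.subspace U" "vec.dim U = s + t"
  obtains A B where "vec.subspace A" "vec.subspace B" "A \<subseteq> U" "B \<subseteq> U" "A \<inter> B = {0}"
    "vec.dim A = s" "vec.dim B = t"
proof -
  obtain D where D: "finite D" "D \<subseteq> U" "vec.independent D" "vec.span D = U" "card D = s + t"
    using vec.basis_subspace_exists[OF assms(1)] assms(2) by metis
  obtain C where C: "C \<subseteq> D" "card C = t"
    using D(1,5) by (metis le_add2 obtain_subset_with_card_n)
  let ?A = "vec.span (D - C)" and ?B = "vec.span C"
  have ind: "vec.independent (D - C)" "vec.independent C"
    using vec.independent_mono[OF D(3)] C(1) by auto
  have dims: "vec.dim ?A = s" "vec.dim ?B = t"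
    using ind C D by (simp_all add: vec.dim_eq_card_independent card_Diff_subset finite_subset)
  have "{x + y |x y. x \<in> ?A \<and> y \<in> ?B} = vec.span ((D - C) \<union> C)"
    by (rule vec.span_Un[symmetric])
  also have "\<dots> = U" using C D by (simp add: Un_absorb2)
  \<comment> \<open>As the sum is all of \<open>U\<close>, the dimension formula leaves dimension 0
    for the intersection.\<close>
  finally have "vec.dim U + vec.dim (?A \<inter> ?B) = s + t"
    using vec.dim_sums_Int[of ?A ?B] dims by simp
  then have "?A \<inter> ?B \<subseteq> {0}"
    using assms(2) by (simp add: vec.dim_eq_0)
  moreover have "?A \<subseteq> U" "?B \<subseteq> U"
    using D C vec.span_mono by blast+
  ultimately show ?thesis
    using that[of ?A ?B] dims vec.span_zero by blast
qed

section \<open>The upper bound\<close>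

definition dot :: "'a::field ^ 'n \<Rightarrow> 'a ^ 'n \<Rightarrow> 'a" where
  "dot u v = (\<Sum>i\<in>UNIV. u $ i * v $ i)"

lemma dot_commute: "dot u v = dot v u"
  by (simp add: dot_def mult.commute)

lemma dot_add: "dot u (v + w) = dot u v + dot u w"
  by (simp add: dot_def distrib_left sum.distrib)

lemma dot_scale: "dot u (c *s v) = c * dot u v"
  by (simp add: dot_def sum_distrib_left mult_ac)

lemma dot_zero: "dot u 0 = 0"
  by (simp add: dot_def)

lemma dot_axis: "dot (axis i 1) v = v $ i"
proof -
  have "(\<Sum>j\<in>UNIV. axis i 1 $ j * v $ j) = (\<Sum>j\<in>UNIV. if j = i then v $ j else 0)"
    by (rule sum.cong) (auto simp: axis_def)
  then show ?thesis by (simp add: dot_def)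
qed

lemma ex_dot_nonzero:
  assumes "v \<noteq> 0"
  obtains u where "dot u v \<noteq> 0"
  using assms dot_axis by (metis vec_eq_iff zero_index)

lemma subspace_dot: "vec.subspace {v. dot u v = 0}"
  by (auto simp: vec.subspace_def dot_add dot_scale dot_zero)

lemma dim_inter_hyperplane:
  fixes W :: "('a::field ^ 'n) set"
  assumes "vec.subspace W" "w \<in> W" "dot u w \<noteq> 0"
  shows "vec.dim W = Suc (vec.dim (W \<inter> {v. dot u v = 0}))"
proof -
  define H where "H = W \<inter> {v. dot u v = 0}"
  have H: "vec.subspace H"
    unfolding H_def by (intro vec.subspace_inter assms subspace_dot)
  have "W = vec.span (insert w H)"
  proof (intro equalityI subsetI)
    fix x assume x: "x \<in> W"
    \<comment> \<open>This multiple of \<open>w\<close> is the one whose subtraction moves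
      \<open>x\<close> into the hyperplane.\<close>
    define c where "c = dot u x / dot u w"
    have "dot u (x - c *s w) = 0"
      using dot_add[of u "x - c *s w" "c *s w"] assms(3) by (simp add: dot_scale c_def)
    moreover have "x - c *s w \<in> W"
      using x assms by (intro vec.subspace_diff vec.subspace_scale)
    ultimately have "x - c *s w \<in> vec.span H"
      by (simp add: H_def vec.span_base)
    then show "x \<in> vec.span (insert w H)"
      unfolding vec.span_insert by blast
  next
    have "insert w H \<subseteq> W"
      using assms by (auto simp: H_def)
    then show "x \<in> W" if "x \<in> vec.span (insert w H)" for x
      using that vec.span_minimal[OF _ assms(1)] by blast
  qed
  then have "vec.dim W = vec.dim (insert w H)"
    by (metis vec.dim_span)
  also have "\<dots> = Suc (vec.dim H)"
  proof -
    have "vec.span H = H" using H by (rule vec.span_eq_iff[THEN iffD2])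
    moreover have "w \<notin> H"
      using assms(3) by (simp add: H_def)
    ultimately have "w \<notin> vec.span H" by blast
    then show ?thesis by (simp add: vec.dim_insert)
  qed
  finally show ?thesis by (simp add: H_def)
qed

text \<open>By symmetry of \<open>dot\<close>, the vectors orthogonal to \<open>v\<close> form the
  hyperplane with normal \<open>v\<close>, of codimension 1.\<close>

lemma card_dot_zero:
  fixes v :: "'a::{field,finite} ^ 'n"
  assumes "v \<noteq> 0"
  shows "CARD('a) * card {u. dot u v = 0} = CARD('a ^ 'n)"
proof -
  obtain u where u: "dot u v \<noteq> 0" using ex_dot_nonzero assms by blast
  have "vec.dim (UNIV :: ('a ^ 'n) set) = Suc (vec.dim {w. dot v w = 0})"
    using dim_inter_hyperplane[of UNIV u v] u vec.subspace_UNIV by (simp add: dot_commute)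
  then have "card (UNIV :: ('a ^ 'n) set) = CARD('a) * card {w. dot v w = 0}"
    using card_vec_subspace[OF vec.subspace_UNIV, where ?'a = 'a and ?'n = 'n]
      card_vec_subspace[OF subspace_dot, of v] by simp
  then show ?thesis by (simp add: dot_commute)
qed

text \<open>
  A nonzero vector is orthogonal to exactly one \<open>q\<close>-th of all \<open>u\<close>; the \<open>u\<close> orthogonal to all
  of \<open>W\<close> contribute more than the average, so some other \<open>u\<close> contributes at most the average.
\<close>

lemma ex_sparse_hyperplane:
  fixes W E :: "('a::{field,finite} ^ 'n) set"
  assumes "vec.dim W > 0" "0 \<notin> E"
  shows "\<exists>u. (\<exists>w\<in>W. dot u w \<noteq> 0) \<and>
    CARD('a) * card (E \<inter> (W \<inter> {v. dot u v = 0})) \<le> card (E \<inter> W)"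
proof (rule ccontr)
  assume neg: "\<not> ?thesis"
  have *: "card (E \<inter> W) < CARD('a) * card (E \<inter> (W \<inter> {v. dot u v = 0}))"
    if "w \<in> W" "dot u w \<noteq> 0" for u w
    using neg that by (meson not_le)
  \<comment> \<open>A nonzero \<open>w\<close> in \<open>W\<close> provides one \<open>u0\<close>
    not vanishing on \<open>W\<close>, which makes the comparison of sums strict.\<close>
  obtain w where w: "w \<in> W" "w \<noteq> 0"
    using assms(1) vec.dim_eq_0[of W] by fastforce
  obtain u0 where u0: "dot u0 w \<noteq> 0" using ex_dot_nonzero w(2) by blast
  have "(\<Sum>u\<in>(UNIV :: ('a ^ 'n) set). card (E \<inter> W)) < (\<Sum>u\<in>UNIV. CARD('a) * card (E \<inter> (W \<inter> {v. dot u v = 0})))"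
  proof (rule sum_strict_mono_ex1)
    show "\<forall>u\<in>UNIV. card (E \<inter> W) \<le> CARD('a) * card (E \<inter> (W \<inter> {v. dot u v = 0}))"
    proof
      fix u
      show "card (E \<inter> W) \<le> CARD('a) * card (E \<inter> (W \<inter> {v. dot u v = 0}))"
      proof (cases "\<exists>x\<in>W. dot u x \<noteq> 0")
        case True
        then show ?thesis using * less_imp_le by blast
      next
        case False
        then have "E \<inter> (W \<inter> {v. dot u v = 0}) = E \<inter> W" by auto
        then show ?thesis by simp
      qed
    qed
    show "\<exists>u\<in>UNIV. card (E \<inter> W) < CARD('a) * card (E \<inter> (W \<inter> {v. dot u v = 0}))"
      using *[OF w(1) u0] by blast
  qed simp
  moreover have "(\<Sum>u\<in>UNIV. CARD('a) * card (E \<inter> (W \<inter> {v. dot u v = 0})))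
      = (\<Sum>u\<in>(UNIV :: ('a ^ 'n) set). card (E \<inter> W))"
  proof -
    \<comment> \<open>Double counting of the orthogonal pairs \<open>(u, v)\<close>;
      \<open>card_dot_zero\<close> applies to every \<open>v\<close> because
      \<open>0 \<notin> E\<close>.\<close>
    have "(\<Sum>u\<in>UNIV. CARD('a) * card (E \<inter> (W \<inter> {v. dot u v = 0})))
        = CARD('a) * (\<Sum>u\<in>UNIV. \<Sum>v\<in>E \<inter> W. if dot u v = 0 then 1 else 0)"
      by (simp add: sum_distrib_left Int_assoc flip: sum.inter_filter)
         (auto intro!: sum.cong arg_cong[where f = card])
    also have "\<dots> = CARD('a) * (\<Sum>v\<in>E \<inter> W. \<Sum>u\<in>UNIV. if dot u v = 0 then 1 else 0)"
      by (subst sum.swap) simp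
    also have "\<dots> = (\<Sum>v\<in>E \<inter> W. CARD('a) * card {u. dot u v = 0})"
      by (simp add: sum_distrib_left flip: sum.inter_filter)
    also have "\<dots> = (\<Sum>v\<in>E \<inter> W. CARD('a ^ 'n))"
      using assms(2) by (intro sum.cong refl card_dot_zero) auto
    finally show ?thesis by simp
  qed
  ultimately show False by simp
qed

section \<open>Counting the holes of a family of subspaces\<close>

definition spread_family :: "nat \<Rightarrow> ('a::field ^ 'n) set set \<Rightarrow> bool" where
  "spread_family t T \<longleftrightarrow> (\<forall>S\<in>T. vec.subspace S \<and> vec.dim S = t) \<and> pairwise (\<lambda>S Y. S \<inter> Y = {0}) T"

text \<open>Zero is excluded explicitly, so it is no hole even for empty \<open>T\<close>, as
  \<open>ex_sparse_hyperplane\<close> demands.\<close>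

definition holes :: "('a::field ^ 'n) set set \<Rightarrow> ('a ^ 'n) set" where
  "holes T = - insert 0 (\<Union>T)"

lemma dim_Int_ge:
  fixes S W :: "('a::field ^ 'n) set"
  assumes "vec.subspace S" "vec.subspace W" "vec.dim W + i = CARD('n)"
  shows "vec.dim S \<le> vec.dim (S \<inter> W) + i"
proof -
  have "vec.dim {x + y |x y. x \<in> S \<and> y \<in> W} \<le> CARD('n)"
    using vec.dim_subset_UNIV by (simp add: vec.dimension_def card_cart_basis)
  then show ?thesis
    using vec.dim_sums_Int[OF assms(1,2)] assms(3) by linarith
qed

text \<open>The nonzero vectors of \<open>W\<close> are partitioned into the holes and the punctured
  intersections \<open>S \<inter> W - {0}\<close>.\<close>

lemma card_holes_Int:
  fixes W :: "('a::{field,finite} ^ 'n) set"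
  assumes T: "spread_family t T" and W: "vec.subspace W"
  shows "int (card (holes T \<inter> W))
    = int CARD('a) ^ vec.dim W - 1 - (\<Sum>S\<in>T. int CARD('a) ^ vec.dim (S \<inter> W) - 1)"
proof -
  have sub: "vec.subspace (S \<inter> W)" if "S \<in> T" for S
    using that T W by (auto simp: spread_family_def intro: vec.subspace_inter)
  have "W - {0} = (holes T \<inter> W) \<union> (\<Union>S\<in>T. S \<inter> W - {0})"
    by (auto simp: holes_def)
  also have "card \<dots> = card (holes T \<inter> W) + card (\<Union>S\<in>T. S \<inter> W - {0})"
    by (rule card_Un_disjoint) (auto simp: holes_def)
  also have "card (\<Union>S\<in>T. S \<inter> W - {0}) = (\<Sum>S\<in>T. card (S \<inter> W - {0}))"
    by (rule card_UN_disjoint) (use T in \<open>auto simp: spread_family_def pairwise_def\<close>)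
  finally have "int (card (W - {0})) = int (card (holes T \<inter> W)) + (\<Sum>S\<in>T. int (card (S \<inter> W - {0})))"
    by simp
  moreover have "int (card (V - {0})) = int CARD('a) ^ vec.dim V - 1"
    if V: "vec.subspace V" for V :: "('a ^ 'n) set"
  proof -
    have "card (V - {0}) = card V - 1" "card V > 0"
      using vec.subspace_0[OF V] by (auto simp: card_gt_0_iff)
    then show ?thesis using card_vec_subspace[OF V] by (simp add: of_nat_diff)
  qed
  ultimately show ?thesis using W sub by simp
qed

text \<open>\<open>W\<close> and all \<open>S \<inter> W\<close> have dimension at least
  \<open>t - i\<close>, so modulo \<open>q ^ (t - i)\<close> only \<open>card T - 2\<close> is left
  of the expression. Modulo \<open>q - 1\<close> every \<open>q ^ k - 1\<close> vanishes. The two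
  moduli are coprime.\<close>

lemma holes_dvd:
  fixes W :: "('a::{field,finite} ^ 'n) set"
  defines "q \<equiv> int CARD('a)"
  assumes T: "spread_family t T" and W: "vec.subspace W" "vec.dim W + i = CARD('n)"
    and t: "i \<le> t" "t \<le> CARD('n)" and M: "q ^ t dvd int (card T) - 2"
  shows "(q - 1) * q ^ (t - i) dvd int (card (holes T \<inter> W)) + q ^ (t - i) - 1"
proof -
  have minus1: "q - 1 dvd q ^ k - 1" for k
    by (simp add: power_diff_1_eq)
  have split: "int (card (holes T \<inter> W)) = q ^ vec.dim W - 1 - (\<Sum>S\<in>T. q ^ vec.dim (S \<inter> W) - 1)"
    unfolding q_def by (rule card_holes_Int[OF T W(1)])
  have "q ^ (t - i) dvd q ^ vec.dim (S \<inter> W)" if "S \<in> T" for S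
  proof (rule le_imp_power_dvd)
    show "t - i \<le> vec.dim (S \<inter> W)"
      using dim_Int_ge[OF _ W(1,2), of S] that T by (auto simp: spread_family_def)
  qed
  then have d1: "q ^ (t - i) dvd (\<Sum>S\<in>T. q ^ vec.dim (S \<inter> W))"
    by (intro dvd_sum) auto
  have d2: "q ^ (t - i) dvd q ^ vec.dim W"
    using W(2) t by (intro le_imp_power_dvd) linarith
  have d3: "q ^ (t - i) dvd int (card T) - 2"
    using M by (meson diff_le_self dvd_trans le_imp_power_dvd)
  have "int (card (holes T \<inter> W)) + q ^ (t - i) - 1
      = q ^ vec.dim W - (\<Sum>S\<in>T. q ^ vec.dim (S \<inter> W)) + (int (card T) - 2) + q ^ (t - i)"
    by (simp add: split sum_subtractf)
  then have "q ^ (t - i) dvd int (card (holes T \<inter> W)) + q ^ (t - i) - 1"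
    using dvd_add[OF dvd_add[OF dvd_diff[OF d2 d1] d3] dvd_refl] by (simp only:)
  moreover have "q - 1 dvd int (card (holes T \<inter> W)) + (q ^ (t - i) - 1)"
    unfolding split by (intro dvd_add dvd_diff dvd_sum minus1)
  then have "q - 1 dvd int (card (holes T \<inter> W)) + q ^ (t - i) - 1"
    by (simp add: algebra_simps)
  moreover have "coprime (q - 1) (q ^ (t - i))"
    by (intro coprime_power_right_iff[THEN iffD2] disjI1 coprime_diff_one_left)
  ultimately show ?thesis
    by (intro divides_mult)
qed

text \<open>Hypothesis \<open>card\<close> describes, with the denominator cleared, one subspace
  more than the claimed maximum. Divisibility and averaging then force an impossible descent through
  hyperplanes.\<close>

lemma no_oversized_spread_family:
  fixes T :: "('a::{field,finite} ^ 'n) set set"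
  defines "q \<equiv> int CARD('a)"
  assumes T: "spread_family t T" and t: "0 < t" "t \<le> CARD('n)"
    and m: "int m * (q - 1) = q ^ r - 1" "m < t"
    and card: "int (card T) * (q ^ t - 1) = q ^ CARD('n) - q ^ (t + r) + 2 * (q ^ t - 1)"
  shows False
proof -
  have q: "q \<ge> 2" unfolding q_def using CARD_field_ge_2[where 'a = 'a] by linarith
  define a where "a W = int (card (holes T \<inter> W))" for W
  \<comment> \<open>Since \<open>q ^ t\<close> is coprime to \<open>q ^ t - 1\<close>, the size
    formula gives \<open>card T\<close> congruent to 2 modulo \<open>q ^ t\<close>.\<close>
  have "(int (card T) - 2) * (q ^ t - 1) = q ^ CARD('n) - q ^ (t + r)"
    using card by (simp add: algebra_simps)
  moreover have "q ^ t dvd q ^ CARD('n) - q ^ (t + r)"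
    using t by (intro dvd_diff le_imp_power_dvd) auto
  ultimately have "q ^ t dvd (int (card T) - 2) * (q ^ t - 1)" by simp
  moreover have "coprime (q ^ t) (q ^ t - 1)"
    by (simp add: coprime_commute coprime_diff_one_left)
  ultimately have M: "q ^ t dvd int (card T) - 2"
    by (simp add: coprime_dvd_mult_left_iff)
  have dvd: "(q - 1) * q ^ (t - i) dvd a W + q ^ (t - i) - 1"
    if "vec.subspace W" "vec.dim W + i = CARD('n)" "i \<le> t" for W i
    unfolding a_def q_def using holes_dvd[OF T that t(2)] M unfolding q_def by blast
  \<comment> \<open>Invariant of the descent: for a suitable \<open>W\<close> of codimension
    \<open>i\<close>, the multiple is at most \<open>m - i\<close>.\<close>
  have "\<exists>W. vec.subspace W \<and> vec.dim W + i = CARD('n) \<and>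
      a W + q ^ (t - i) - 1 \<le> (int m - int i) * ((q - 1) * q ^ (t - i))" if "i \<le> m" for i
    using that
  proof (induction i)
    case 0
    have "vec.dim (UNIV :: ('a ^ 'n) set) = CARD('n)" by (rule vec_dim_card)
    moreover have "a UNIV = q ^ CARD('n) - 1 - int (card T) * (q ^ t - 1)"
    proof -
      have "a UNIV = q ^ CARD('n) - 1 - (\<Sum>S\<in>T. q ^ vec.dim (S \<inter> UNIV) - 1)"
        unfolding a_def q_def using card_holes_Int[OF T vec.subspace_UNIV]
        by (simp only: vec_dim_card)
      also have "(\<Sum>S\<in>T. q ^ vec.dim (S \<inter> UNIV) - 1) = (\<Sum>S\<in>T. q ^ t - 1)"
        using T by (intro sum.cong) (auto simp: spread_family_def)
      finally show ?thesis by simp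
    qed
    \<comment> \<open>Inserting the size leaves \<open>q ^ (t + r) - q ^ t\<close>, so the multiple
      for the whole space is exactly \<open>m\<close>.\<close>
    then have "a UNIV + q ^ t - 1 = (q ^ r - 1) * q ^ t"
      unfolding card by (simp add: power_add algebra_simps)
    then have "a UNIV + q ^ t - 1 = int m * ((q - 1) * q ^ t)"
      unfolding m(1)[symmetric] by (simp add: mult.assoc)
    ultimately show ?case
      by (intro exI[of _ UNIV]) (simp add: vec.subspace_UNIV)
  next
    case (Suc i)
    then obtain W where W: "vec.subspace W" "vec.dim W + i = CARD('n)"
      and aW: "a W + q ^ (t - i) - 1 \<le> (int m - int i) * ((q - 1) * q ^ (t - i))"
      by auto
    have i: "Suc i \<le> m" by fact
    have "vec.dim W > 0" using W(2) i m(2) t(2) by linarith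
    then obtain u w where w: "w \<in> W" "dot u w \<noteq> 0"
      and le: "CARD('a) * card (holes T \<inter> (W \<inter> {v. dot u v = 0})) \<le> card (holes T \<inter> W)"
      using ex_sparse_hyperplane[of W "holes T"] by (auto simp: holes_def)
    define H where "H = W \<inter> {v. dot u v = 0}"
    have H: "vec.subspace H"
      unfolding H_def by (intro vec.subspace_inter W subspace_dot)
    have dimH: "vec.dim H + Suc i = CARD('n)"
      using dim_inter_hyperplane[OF W(1) w] W(2) by (simp add: H_def)
    have aH: "q * a H \<le> a W"
      using le unfolding a_def q_def H_def of_nat_mult[symmetric] of_nat_le_iff .
    define Q where "Q = q ^ (t - Suc i)"
    have Q: "q ^ (t - i) = q * Q"
      using i m(2) by (simp add: Q_def flip: power_Suc) (simp add: Suc_diff_Suc)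
    have Q0: "Q > 0" using q by (simp add: Q_def)
    obtain k where k: "a H + Q - 1 = (q - 1) * Q * k"
      using dvd[OF H dimH] i m(2) unfolding Q_def by (metis dvdE le_trans less_imp_le)
    \<comment> \<open>The left side subtracts \<open>q\<close> where the bound for \<open>W\<close>
      subtracts only 1, so the inequality is strict. Both sides being multiples of
      \<open>(q - 1) * Q\<close>, the multiple drops by at least one.\<close>
    have "q * (a H + Q - 1) = q * a H + q * Q - q" by (simp add: algebra_simps)
    also have "\<dots> < (int m - int i) * ((q - 1) * (q * Q))"
      using aH aW[unfolded Q] q by linarith
    also have "\<dots> = q * ((int m - int i) * ((q - 1) * Q))" by simp
    finally have "a H + Q - 1 < (int m - int i) * ((q - 1) * Q)"
      using q by simp
    then have "k * ((q - 1) * Q) < (int m - int i) * ((q - 1) * Q)"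
      unfolding k by (simp only: mult.commute)
    then have "k < int m - int i"
      using q Q0 by (simp add: mult_less_cancel_right)
    then have "k * ((q - 1) * Q) \<le> (int m - int (Suc i)) * ((q - 1) * Q)"
      using q Q0 by (intro mult_right_mono) auto
    then have "a H + Q - 1 \<le> (int m - int (Suc i)) * ((q - 1) * Q)"
      unfolding k by (simp only: mult.commute)
    then show ?case using H dimH unfolding Q_def by blast
  qed
  then obtain W where W: "a W + q ^ (t - m) - 1 \<le> (int m - int m) * ((q - 1) * q ^ (t - m))"
    by blast
  \<comment> \<open>At \<open>i = m\<close> the bound is 0, while \<open>m < t\<close> makes the
    left side positive.\<close>
  have "q ^ (t - m) > 1" using q m(2) by (intro one_less_power) auto
  moreover have "a W \<ge> 0" by (simp add: a_def)
  ultimately show False using W by simp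
qed

section \<open>Finite extensions of a finite field\<close>

text \<open>Multiplication by a nonzero \<open>x\<close> permutes the nonzero elements; comparing
  their products gives the claim.\<close>

lemma finite_field_power_CARD:
  fixes x :: "'a::{field,finite}"
  shows "x ^ CARD('a) = x"
proof (cases "x = 0")
  case False
  have "(\<Prod>y\<in>UNIV-{0}. y) = (\<Prod>y\<in>UNIV-{0}. x * y)"
    by (rule prod.reindex_bij_witness[of _ "\<lambda>y. x * y" "\<lambda>y. y / x"]) (use False in auto)
  also have "\<dots> = x ^ (CARD('a) - 1) * (\<Prod>y\<in>UNIV-{0}. y)"
    by (simp add: prod.distrib)
  finally have "x ^ (CARD('a) - 1) = 1"
    by simp
  then show ?thesis
    using power_minus_mult[of "CARD('a)" x] by simp
qed simp

lemma to_ac_power_CARD: "to_ac x ^ CARD('a) = to_ac (x :: 'a::{field,finite})"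
  by (metis finite_field_power_CARD to_ac_power)

lemma card_range_to_ac: "card (range (to_ac :: 'a::{field,finite} \<Rightarrow> _)) = CARD('a)"
  by (simp add: card_image inj_to_ac)

text \<open>
  Two monic polynomials of degree \<open>q\<close> that agree on the \<open>q\<close> elements of the base field are equal.
  Using this twice, first with \<open>y\<close> in the base field, gives additivity of the Frobenius map
  without knowing that \<open>q\<close> is a power of the characteristic.
\<close>

lemma frobenius_add_aux:
  fixes y z :: "'a::{field,finite} alg_closure"
  assumes base: "\<And>c. (to_ac c + y) ^ CARD('a) = to_ac c + z"
  shows "(x + y) ^ CARD('a) = x ^ CARD('a) + z"
proof -
  define q where "q = CARD('a)"
  have q: "q > 0" by (simp add: q_def)
  have "[:y, 1:] ^ q = monom 1 q + [:z:]"
  proof (rule poly_eqI_degree_lead_coeff[where n = q and A = "range (to_ac :: 'a \<Rightarrow> _)"])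
    show "coeff ([:y, 1:] ^ q) q = coeff (monom 1 q + [:z:]) q"
      using q by (simp add: coeff_linear_power coeff_pCons split: nat.splits)
    show "q \<le> card (range (to_ac :: 'a \<Rightarrow> _))"
      by (simp add: card_range_to_ac q_def)
    show "degree ([:y, 1:] ^ q) \<le> q"
      by (simp add: degree_linear_power)
    show "degree (monom 1 q + [:z:]) \<le> q"
      by (intro degree_add_le) (auto simp: degree_monom_le)
    show "poly ([:y, 1:] ^ q) w = poly (monom 1 q + [:z:]) w" if w: "w \<in> range to_ac" for w
      using w base by (auto simp: poly_monom q_def to_ac_power_CARD add.commute)
  qed
  then have "poly ([:y, 1:] ^ q) x = poly (monom 1 q + [:z:]) x" by simp
  then show ?thesis
    by (simp add: poly_monom q_def add.commute)
qed

lemma frobenius_add: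
  fixes x y :: "'a::{field,finite} alg_closure"
  shows "(x + y) ^ CARD('a) = x ^ CARD('a) + y ^ CARD('a)"
proof (rule frobenius_add_aux)
  fix c :: 'a
  have "(y + to_ac c) ^ CARD('a) = y ^ CARD('a) + to_ac c"
    by (rule frobenius_add_aux) (metis to_ac_add to_ac_power_CARD)
  then show "(to_ac c + y) ^ CARD('a) = to_ac c + y ^ CARD('a)"
    by (simp add: add.commute)
qed

lemma frobenius_power_add:
  fixes x y :: "'a::{field,finite} alg_closure"
  shows "(x + y) ^ (CARD('a) ^ s) = x ^ (CARD('a) ^ s) + y ^ (CARD('a) ^ s)"
  by (induction s) (simp_all add: power_mult frobenius_add mult.commute[of "CARD('a)"])

section \<open>Simple roots and the subfield of order q^s\<close>

lemma alg_closed_card_roots_simple: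
  fixes p :: "'a::alg_closed_field poly"
  assumes "p \<noteq> 0" and simple: "\<And>x. poly p x = 0 \<Longrightarrow> poly (pderiv p) x \<noteq> 0"
  shows "card {x. poly p x = 0} = degree p"
proof -
  obtain A where A: "size A = degree p"
    and pA: "p = smult (lead_coeff p) (\<Prod>x\<in>#A. [:-x, 1:])"
    using alg_closed_imp_factorization[OF \<open>p \<noteq> 0\<close>] by blast
  have lc: "lead_coeff p \<noteq> 0" using \<open>p \<noteq> 0\<close> by simp
  have roots: "{x. poly p x = 0} = set_mset A"
    by (subst pA) (use lc in \<open>auto simp: poly_prod_mset prod_mset_zero_iff\<close>)
  \<comment> \<open>A repeated linear factor would make \<open>x\<close> a common root of
    \<open>p\<close> and its derivative, so the multiset of roots is a set.\<close>
  have "count A x \<le> 1" for x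
  proof (rule ccontr)
    assume "\<not> count A x \<le> 1"
    then have "{#x, x#} \<subseteq># A"
      by (auto simp: subseteq_mset_def)
    then obtain B where "A = add_mset x (add_mset x B)"
      by (auto simp: mset_subset_eq_exists_conv)
    then obtain g where g: "p = [:-x, 1:] * ([:-x, 1:] * g)"
      using pA by (metis (no_types, lifting) image_mset_add_mset mult_smult_right prod_mset.add_mset)
    have "poly p x = 0"
      by (subst g) simp
    moreover have "poly (pderiv p) x = 0"
      unfolding g pderiv_mult by simp
    ultimately show False using simple by blast
  qed
  then have "A = mset_set (set_mset A)"
    by (intro multiset_eqI) (metis count_eq_zero_iff count_mset_set(1) count_mset_set(3) finite_set_mset le_antisym less_one not_le)
  then have "card (set_mset A) = size A"
    by (metis size_mset_set)
  then show ?thesis using A roots by simp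
qed

text \<open>The subfield of order q^s, as the roots of X^(q^s) - X. For \<open>s = 0\<close> the
  condition is trivial and gives the whole closure, hence \<open>s > 0\<close> in
  \<open>card_ext_field\<close>.\<close>

definition ext_field :: "'a::{field,finite} itself \<Rightarrow> nat \<Rightarrow> 'a alg_closure set" where
  "ext_field _ s = {x. x ^ (CARD('a) ^ s) = x}"

lemma ext_field_mult:
  "x \<in> ext_field TYPE('a::{field,finite}) s \<Longrightarrow> y \<in> ext_field TYPE('a) s \<Longrightarrow> x * y \<in> ext_field TYPE('a) s"
  by (simp add: ext_field_def power_mult_distrib)

lemma ext_field_add:
  "x \<in> ext_field TYPE('a::{field,finite}) s \<Longrightarrow> y \<in> ext_field TYPE('a) s \<Longrightarrow> x + y \<in> ext_field TYPE('a) s"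
  by (simp add: ext_field_def frobenius_power_add)

lemma to_ac_in_ext_field: "to_ac c \<in> ext_field TYPE('a::{field,finite}) s"
proof -
  have "to_ac c ^ (CARD('a) ^ s) = to_ac c"
    by (induction s) (simp_all add: power_mult to_ac_power_CARD)
  then show ?thesis by (simp add: ext_field_def)
qed

text \<open>Translation by 1 permutes the base field, so adding 1 to each element leaves the total
  sum unchanged.\<close>

lemma of_nat_CARD_ac: "of_nat CARD('a) = (0 :: 'a::{field,finite} alg_closure)"
proof -
  have "(\<Sum>x\<in>UNIV. x) = (\<Sum>x\<in>UNIV. x + 1 :: 'a)"
    by (rule sum.reindex_bij_witness[of _ "\<lambda>x. x + 1" "\<lambda>x. x - 1"]) auto
  then have "of_nat CARD('a) = (0 :: 'a)"
    by (simp add: sum.distrib)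
  then show ?thesis
    by (metis to_ac_0 to_ac_of_nat)
qed

text \<open>The polynomial X^(q^s) - X has derivative -1, because q^s is 0 in the closure; hence all
  its roots are simple.\<close>

lemma card_ext_field:
  assumes "s > 0"
  shows "card (ext_field TYPE('a::{field,finite}) s) = CARD('a) ^ s"
proof -
  define N where "N = CARD('a) ^ s"
  have N: "N > 1"
    unfolding N_def using CARD_field_ge_2[where 'a = 'a] assms by (intro one_less_power) auto
  have N0: "of_nat N = (0 :: 'a alg_closure)"
    using assms by (simp add: N_def of_nat_CARD_ac)
  define p :: "'a alg_closure poly" where "p = monom 1 N - [:0, 1:]"
  have p: "p = monom 1 N + [:0, -1:]"
    by (simp add: p_def)
  have deg: "degree p = N"
    unfolding p using N by (subst degree_add_eq_left) (auto simp: degree_monom_eq)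
  have "card {x. poly p x = 0} = degree p"
  proof (rule alg_closed_card_roots_simple)
    show "p \<noteq> 0" using deg N by auto
    show "poly (pderiv p) x \<noteq> 0" for x
      by (simp add: p pderiv_add pderiv_monom N0 pderiv_pCons)
  qed
  moreover have "{x. poly p x = 0} = ext_field TYPE('a) s"
    by (auto simp: p_def poly_monom ext_field_def N_def)
  ultimately show ?thesis using deg by (simp add: N_def)
qed

section \<open>The lower bound\<close>

abbreviation ac_scale :: "'a::field \<Rightarrow> 'a alg_closure \<Rightarrow> 'a alg_closure" where
  "ac_scale c x \<equiv> to_ac c * x"

interpretation ac: vector_space ac_scale
  by standard (simp_all add: algebra_simps)

text \<open>Both directions are used: one map embeds \<open>B\<close> into the extension field,
  another carries products back to \<open>A\<close>.\<close>

interpretation vec_ac: vector_space_pair "(*s) :: 'a::field \<Rightarrow> 'a ^ 'n \<Rightarrow> 'a ^ 'n" ac_scale ..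

interpretation ac_vec: vector_space_pair ac_scale "(*s) :: 'a::field \<Rightarrow> 'a ^ 'n \<Rightarrow> 'a ^ 'n" ..

text \<open>
  A rank metric code: identifying \<open>A\<close> with the field of order \<open>q\<^sup>s\<close> and \<open>B\<close> with a subspace of it,
  the maps \<open>h a\<close> are the multiplications by \<open>a\<close>.
\<close>

lemma ex_linear_maps_inj_differences:
  fixes A B :: "('a::{field,finite} ^ 'n) set"
  assumes A: "vec.subspace A" and B: "vec.subspace B"
    and dims: "vec.dim B \<le> vec.dim A" "0 < vec.dim A"
  shows "\<exists>(I :: 'a alg_closure set) h. card I = CARD('a) ^ vec.dim A \<and>
    (\<forall>a\<in>I. Vector_Spaces.linear (*s) (*s) (h a)) \<and> (\<forall>a\<in>I. h a ` B \<subseteq> A) \<and>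
    (\<forall>a\<in>I. \<forall>b\<in>I. \<forall>x\<in>B. a \<noteq> b \<longrightarrow> h a x = h b x \<longrightarrow> x = 0)"
proof -
  define K where "K = ext_field TYPE('a) (vec.dim A)"
  have cardK: "card K = CARD('a) ^ vec.dim A"
    unfolding K_def using dims by (intro card_ext_field) auto
  have "finite K"
    using cardK by (intro card_ge_0_finite) simp
  have K0: "0 \<in> K" using to_ac_in_ext_field[of 0] by (simp add: K_def)
  have "ac.subspace K"
    unfolding ac.subspace_def using K0
    by (auto simp: K_def to_ac_in_ext_field ext_field_add ext_field_mult)
  then obtain C where C: "finite C" "ac.independent C" "ac.span C = K" "card K = CARD('a) ^ card C"
    using ac.finite_subspace_basis[OF finite \<open>finite K\<close>] by blast
  \<comment> \<open>Counting \<open>K\<close> in two ways shows that its dimension over the base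
    field is that of \<open>A\<close>.\<close>
  have cardC: "card C = vec.dim A"
    using C(4) cardK CARD_field_ge_2[where 'a = 'a] by simp
  obtain D where D: "finite D" "vec.independent D" "vec.span D = A" "card D = vec.dim A"
    using vec.basis_subspace_exists[OF A] by metis
  obtain G where G: "finite G" "vec.independent G" "vec.span G = B" "card G = vec.dim B"
    using vec.basis_subspace_exists[OF B] by metis
  obtain f where f: "Vector_Spaces.linear (*s) ac_scale f" "inj_on f B" "f ` B \<subseteq> K"
    using vec_ac.exists_linear_inj_on_span[OF G(1,2) C(1,2)] G C cardC dims by metis
  obtain g where g: "Vector_Spaces.linear ac_scale (*s) g" "inj_on g K" "g ` K \<subseteq> A"
    using ac_vec.exists_linear_inj_on_span[OF C(1,2) D(1,2)] D C cardC by (metis order_refl)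
  interpret f: Vector_Spaces.linear "(*s)" ac_scale f by fact
  interpret g: Vector_Spaces.linear ac_scale "(*s)" g by fact
  define h where "h a x = g (a * f x)" for a x
  show ?thesis
  proof (intro exI conjI ballI impI)
    show "card K = CARD('a) ^ vec.dim A" by fact
  next
    fix a assume "a \<in> K"
    have "g (a * (to_ac c * f x)) = c *s g (a * f x)" for c x
      using g.scale[of c "a * f x"] by (simp add: mult.left_commute)
    then show "Vector_Spaces.linear (*s) (*s) (h a)"
      by unfold_locales (simp_all add: h_def f.add g.add f.scale distrib_left)
  next
    fix a assume "a \<in> K"
    then show "h a ` B \<subseteq> A"
      using f(3) g(3) ext_field_mult unfolding h_def K_def by blast
  next
    fix a b x assume ab: "a \<in> K" "b \<in> K" and x: "x \<in> B" and ne: "a \<noteq> b" and eq: "h a x = h b x"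
    have fx: "f x \<in> K" using f(3) x by blast
    \<comment> \<open>\<open>g\<close> is injective on \<open>K\<close>; cancelling
      \<open>a \<noteq> b\<close> in the field then leaves \<open>f x = 0\<close>.\<close>
    have "a * f x = b * f x"
      using g(2) eq ab fx ext_field_mult unfolding h_def K_def inj_on_def by blast
    then have "f x = f 0" using ne by (simp add: f.zero)
    then show "x = 0"
      using f(2) x vec.subspace_0[OF B] unfolding inj_on_def by blast
  qed
qed

section \<open>Graphs of linear maps as new spread elements\<close>

lemma graph_subspace:
  fixes B :: "('a::field ^ 'n) set"
  assumes h: "Vector_Spaces.linear (*s) (*s) h" and B: "vec.subspace B"
    and A: "vec.subspace A" "h ` B \<subseteq> A" "A \<inter> B = {0}"
  shows "vec.subspace ((\<lambda>x. x + h x) ` B)" "vec.dim ((\<lambda>x. x + h x) ` B) = vec.dim B"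
proof -
  interpret h: Vector_Spaces.linear "(*s)" "(*s)" h by fact
  have lin: "Vector_Spaces.linear (*s) (*s) (\<lambda>x. x + h x)"
    by unfold_locales (simp_all add: h.add h.scale vec.scale_right_distrib)
  interpret l: Vector_Spaces.linear "(*s)" "(*s)" "\<lambda>x. x + h x" by fact
  show "vec.subspace ((\<lambda>x. x + h x) ` B)"
    by (rule l.subspace_image[OF B])
  \<comment> \<open>The graph map has trivial kernel on \<open>B\<close>: such an \<open>x\<close>
    equals \<open>- h x\<close> and so lies in \<open>A \<inter> B\<close>.\<close>
  have "x = 0" if x: "x \<in> B" "x + h x = 0" for x
  proof -
    have "x = - h x" using x(2) by (simp add: eq_neg_iff_add_eq_0)
    moreover have "- h x \<in> A" using x A by (auto intro: vec.subspace_neg)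
    ultimately show ?thesis using x(1) A(3) by auto
  qed
  then have "inj_on (\<lambda>x. x + h x) B"
    unfolding l.inj_on_iff_eq_0[OF B] by blast
  moreover have "vec.span B = B" using B by (rule vec.span_eq_iff[THEN iffD2])
  ultimately show "vec.dim ((\<lambda>x. x + h x) ` B) = vec.dim B"
    using vec.dim_image_eq[OF lin] by metis
qed

lemma direct_sum_unique:
  fixes A B :: "('a::field ^ 'n) set"
  assumes A: "vec.subspace A" and B: "vec.subspace B" and AB: "A \<inter> B = {0}"
    and x: "x \<in> B" "y \<in> B" and h: "a \<in> A" "b \<in> A" and eq: "x + a = y + b"
  shows "x = y" "a = b"
proof -
  have "x - y = b - a" using eq by (simp add: algebra_simps)
  moreover have "x - y \<in> B" using x B by (rule vec.subspace_diff[rotated])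
  moreover have "b - a \<in> A" using h A by (intro vec.subspace_diff)
  ultimately have "x - y \<in> A \<inter> B" by (metis IntI)
  then have "x - y = 0" unfolding AB by (rule singletonD)
  then show "x = y" by simp
  then show "a = b" using eq by simp
qed

text \<open>The graphs of the maps \<open>h a\<close> are added. A common vector of two graphs has
  unique components in \<open>B\<close> and \<open>A\<close>, so the two maps agree at its
  \<open>B\<close>-component, which must be 0. Members of \<open>T\<close> lie in \<open>A\<close>,
  which every graph meets trivially.\<close>

lemma spread_family_extend:
  fixes A B :: "('a::{field,finite} ^ 'n) set"
  assumes A: "vec.subspace A" and B: "vec.subspace B" and AB: "A \<inter> B = {0}"
    and dims: "vec.dim B = t" "t \<le> vec.dim A" "0 < t"
    and U: "vec.subspace U" "A \<subseteq> U" "B \<subseteq> U"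
    and T: "spread_family t T" "\<Union>T \<subseteq> A"
  obtains T' where "spread_family t T'" "\<Union>T' \<subseteq> U" "card T' = card T + CARD('a) ^ vec.dim A"
proof -
  have pre: "vec.dim B \<le> vec.dim A" "0 < vec.dim A" using dims by auto
  obtain I :: "'a alg_closure set" and h where I: "card I = CARD('a) ^ vec.dim A"
    and lin': "\<forall>a\<in>I. Vector_Spaces.linear (*s) (*s) (h a)"
    and img': "\<forall>a\<in>I. h a ` B \<subseteq> A"
    and diff': "\<forall>a\<in>I. \<forall>b\<in>I. \<forall>x\<in>B. a \<noteq> b \<longrightarrow> h a x = h b x \<longrightarrow> x = 0"
    using ex_linear_maps_inj_differences[OF A B pre] by (elim exE conjE)
  note lin = lin'[rule_format] and img = img'[rule_format] and diff = diff'[rule_format]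
  define G where "G a = (\<lambda>x. x + h a x) ` B" for a
  have G: "vec.subspace (G a)" "vec.dim (G a) = t" if "a \<in> I" for a
    using graph_subspace[OF lin[OF that] B A img[OF that] AB] dims by (simp_all add: G_def)
  have h0: "h a 0 = 0" if "a \<in> I" for a
    using lin[OF that] by (rule vec.linear_0)
  have GA: "A \<inter> G a = {0}" if a: "a \<in> I" for a
  proof -
    have "v = 0" if v: "v \<in> A" "v \<in> G a" for v
    proof -
      obtain x where x: "x \<in> B" "v = x + h a x" using v by (auto simp: G_def)
      have hx: "h a x \<in> A" using img[OF a] x by blast
      have "x = 0"
        by (rule direct_sum_unique(1)[OF A B AB x(1) vec.subspace_0[OF B] hx v(1)])
           (simp add: x(2))
      then show ?thesis using x h0[OF a] by simp
    qed
    then show ?thesis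
      using vec.subspace_0[OF A] vec.subspace_0[OF G(1)[OF a]] by blast
  qed
  have GG: "G a \<inter> G b = {0}" if ab: "a \<in> I" "b \<in> I" "a \<noteq> b" for a b
  proof -
    have "v = 0" if v: "v \<in> G a" "v \<in> G b" for v
    proof -
      obtain x y where x: "x \<in> B" "v = x + h a x" and y: "y \<in> B" "v = y + h b y"
        using v by (auto simp: G_def)
      have hx: "h a x \<in> A" "h b y \<in> A" using img ab x y by blast+
      have "x = y" "h a x = h b y"
        using direct_sum_unique[OF A B AB x(1) y(1) hx] x(2) y(2) by auto
      then have "x = 0" using diff[OF ab(1,2) x(1) ab(3)] by simp
      then show ?thesis using x h0 ab by simp
    qed
    then show ?thesis
      using vec.subspace_0[OF G(1)] ab by blast
  qed
  \<comment> \<open>Equal graphs would intersect in dimension \<open>t > 0\<close>, not in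
    \<open>{0}\<close>; likewise for a graph that belongs to \<open>T\<close>.\<close>
  have inj: "inj_on G I"
  proof (rule inj_onI, rule ccontr)
    fix a b assume ab: "a \<in> I" "b \<in> I" "G a = G b" "a \<noteq> b"
    show False
      using vec_subspace_inter_nontrivial[of "G a" "G a" "G b"] GG[OF ab(1,2,4)] G(2)[OF ab(1)] ab(3) dims(3)
      by auto
  qed
  have TG: "S \<inter> G a = {0}" if "S \<in> T" "a \<in> I" for S a
  proof -
    have "0 \<in> S \<inter> G a"
      using that T(1) G(1) by (auto simp: spread_family_def intro: vec.subspace_0)
    then show ?thesis using GA[OF that(2)] T(2) that(1) by blast
  qed
  have disj: "T \<inter> G ` I = {}"
  proof -
    have False if a: "a \<in> I" "G a \<in> T" for a
      using vec_subspace_inter_nontrivial[of "G a" "G a" "G a"] TG[OF a(2,1)] G(2)[OF a(1)] dims(3)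
      by auto
    then show ?thesis by blast
  qed
  show thesis
  proof
    show "spread_family t (T \<union> G ` I)"
      unfolding spread_family_def
    proof (intro conjI ballI pairwiseI)
      fix S assume "S \<in> T \<union> G ` I"
      then show "vec.subspace S" "vec.dim S = t"
        using T(1) G by (auto simp: spread_family_def)
    next
      fix S Y assume S: "S \<in> T \<union> G ` I" and Y: "Y \<in> T \<union> G ` I" and ne: "S \<noteq> Y"
      have TT: "S \<inter> Y = {0}" if "S \<in> T" "Y \<in> T"
        using T(1) that ne by (simp add: spread_family_def pairwise_def)
      show "S \<inter> Y = {0}"
        using S Y
      proof (elim UnE imageE)
        fix a b assume "S = G a" "Y = G b" "a \<in> I" "b \<in> I"
        then show ?thesis using GG ne by blast
      next
        fix a assume "S = G a" "a \<in> I" "Y \<in> T"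
        then show ?thesis using TG[of Y a] by (simp only: Int_commute)
      qed (simp_all only: TT TG)
    qed
    have "G a \<subseteq> U" if "a \<in> I" for a
    proof -
      have "x \<in> U" "h a x \<in> U" if "x \<in> B" for x
        using that U img[OF \<open>a \<in> I\<close>] by blast+
      then show ?thesis
        unfolding G_def using U(1) by (auto intro: vec.subspace_add)
    qed
    then show "\<Union>(T \<union> G ` I) \<subseteq> U" using T(2) U(2) by blast
    have "finite (T :: ('a ^ 'n) set set)" "finite (G ` I)" by simp_all
    then show "card (T \<union> G ` I) = card T + CARD('a) ^ vec.dim A"
      using card_Un_disjoint disj card_image[OF inj] I by metis
  qed
qed

text \<open>Splitting off \<open>t\<close> dimensions contributes \<open>q ^ s\<close> new members,
  and \<open>q ^ s * (q ^ t - 1)\<close> telescopes down to dimension \<open>t + r\<close>. There a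
  single subspace remains, which accounts for the last summand \<open>q ^ t - 1\<close>.\<close>

lemma ex_spread_family:
  fixes U :: "('a::{field,finite} ^ 'n) set"
  defines "q \<equiv> int CARD('a)"
  assumes "0 < t" "vec.subspace U" "vec.dim U = (k + 1) * t + r"
  shows "\<exists>T. spread_family t T \<and> \<Union>T \<subseteq> U \<and>
    int (card T) * (q ^ t - 1) = q ^ vec.dim U - q ^ (t + r) + (q ^ t - 1)"
  using assms(3,4)
proof (induction k arbitrary: U)
  case 0
  then have "t \<le> vec.dim U" by simp
  then obtain S where S: "vec.subspace S" "S \<subseteq> vec.span U" "vec.dim S = t"
    by (rule vec.choose_subspace_of_subspace)
  have "vec.span U = U" using 0(1) by (rule vec.span_eq_iff[THEN iffD2])
  then have "S \<subseteq> U" using S(2) by metis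
  then show ?case
    using S 0 by (intro exI[of _ "{S}"]) (simp add: spread_family_def)
next
  case (Suc k)
  let ?s = "(k + 1) * t + r"
  have "vec.dim U = ?s + t" using Suc.prems by simp
  then obtain A B where AB: "vec.subspace A" "vec.subspace B" "A \<subseteq> U" "B \<subseteq> U" "A \<inter> B = {0}"
    "vec.dim A = ?s" "vec.dim B = t"
    using vec_subspace_split[OF Suc.prems(1)] by metis
  obtain T where T: "spread_family t T" "\<Union>T \<subseteq> A"
    "int (card T) * (q ^ t - 1) = q ^ ?s - q ^ (t + r) + (q ^ t - 1)"
    using Suc.IH[OF AB(1,6)] AB(6) by auto
  have "t \<le> vec.dim A" using AB(6) by simp
  then obtain T' where T': "spread_family t T'" "\<Union>T' \<subseteq> U" "card T' = card T + CARD('a) ^ ?s"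
    using spread_family_extend[OF AB(1,2,5,7) _ assms(2) Suc.prems(1) AB(3,4) T(1,2)] AB(6) by metis
  have "int (card T') * (q ^ t - 1) = int (card T) * (q ^ t - 1) + q ^ ?s * (q ^ t - 1)"
    by (simp add: T'(3) q_def algebra_simps)
  also have "\<dots> = q ^ (?s + t) - q ^ (t + r) + (q ^ t - 1)"
    unfolding T(3) by (simp add: power_add algebra_simps)
  finally show ?case
    using T' \<open>vec.dim U = ?s + t\<close> by metis
qed

section \<open>From subspaces to projective point sets\<close>

definition pg_points_in :: "('a::field ^ 'n) set \<Rightarrow> ('a ^ 'n) set set" where
  "pg_points_in U = {P \<in> pg_points. P \<subseteq> U}"

text \<open>A nonzero common vector spans a common point; conversely, a common point has dimension 1
  and prevents a trivial intersection.\<close>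

lemma disjnt_pg_points_in_iff:
  fixes U V :: "('a::field ^ 'n) set"
  assumes U: "vec.subspace U" and V: "vec.subspace V"
  shows "disjnt (pg_points_in U) (pg_points_in V) \<longleftrightarrow> U \<inter> V = {0}"
proof
  assume dis: "disjnt (pg_points_in U) (pg_points_in V)"
  have "v = 0" if v: "v \<in> U" "v \<in> V" for v
  proof (rule ccontr)
    assume "v \<noteq> 0"
    then have "vec.span {v} \<in> pg_points"
      by (simp add: pg_points_def)
    moreover have "vec.span {v} \<subseteq> U" "vec.span {v} \<subseteq> V"
      using v U V by (simp_all add: vec.span_minimal)
    ultimately show False
      using dis by (auto simp: disjnt_iff pg_points_in_def)
  qed
  then show "U \<inter> V = {0}"
    using vec.subspace_0[OF U] vec.subspace_0[OF V] by blast
next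
  assume *: "U \<inter> V = {0}"
  have False if P: "P \<in> pg_points" "P \<subseteq> U" "P \<subseteq> V" for P
    using vec_subspace_inter_nontrivial[of P U V] P * by (simp add: pg_points_def)
  then show "disjnt (pg_points_in U) (pg_points_in V)"
    by (auto simp: disjnt_iff pg_points_in_def)
qed

text \<open>Positivity of \<open>t\<close> lets the truncated \<open>t - 1\<close> and the
  \<open>d + 1\<close> of the definition cancel.\<close>

lemma pg_subspaces_eq:
  assumes "0 < t"
  shows "pg_subspaces (t - 1) = pg_points_in ` {U. vec.subspace U \<and> vec.dim U = t}"
  using assms by (auto simp: pg_subspaces_def pg_points_in_def)

lemma partial_spread_of_spread_family:
  assumes "0 < t" and T: "spread_family t T"
  shows "partial_spread (t - 1) (pg_points_in ` T)" "inj_on pg_points_in T"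
proof -
  have sub: "vec.subspace U" "vec.dim U = t" if "U \<in> T" for U
    using T that by (auto simp: spread_family_def)
  have int: "U \<inter> V = {0}" if "U \<in> T" "V \<in> T" "U \<noteq> V" for U V
    using T that by (simp add: spread_family_def pairwise_def)
  show "inj_on pg_points_in T"
  proof (rule inj_onI, rule ccontr)
    fix U V assume UV: "U \<in> T" "V \<in> T" "pg_points_in U = pg_points_in V" "U \<noteq> V"
    \<comment> \<open>Distinct members with equal point sets would make that set disjoint from
      itself, forcing \<open>U \<inter> U = {0}\<close> against dimension
      \<open>t > 0\<close>.\<close>
    have "disjnt (pg_points_in U) (pg_points_in V)"
      using UV disjnt_pg_points_in_iff sub int by blast
    then have "disjnt (pg_points_in U) (pg_points_in U)"
      using UV(3) by simp
    then have "U \<inter> U = {0}"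
      using disjnt_pg_points_in_iff sub UV(1) by blast
    moreover have "0 < vec.dim U"
      using sub(2)[OF UV(1)] assms(1) by simp
    ultimately show False
      using vec_subspace_inter_nontrivial[OF _ order_refl order_refl] by metis
  qed
  have "pairwise disjnt (pg_points_in ` T)"
  proof (rule pairwiseI)
    fix s s' assume "s \<in> pg_points_in ` T" "s' \<in> pg_points_in ` T" "s \<noteq> s'"
    then show "disjnt s s'"
      using disjnt_pg_points_in_iff sub(1) int by blast
  qed
  then show "partial_spread (t - 1) (pg_points_in ` T)"
    using sub unfolding partial_spread_def pg_subspaces_eq[OF assms(1)] by blast
qed

lemma spread_family_of_partial_spread:
  fixes S :: "('a::field ^ 'n) set set set"
  assumes "0 < t" and S: "partial_spread (t - 1) S"
  obtains T :: "('a ^ 'n) set set" where "spread_family t T" "card T = card S"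
proof -
  have "\<forall>s\<in>S. \<exists>U. s = pg_points_in U \<and> vec.subspace U \<and> vec.dim U = t"
    using S unfolding partial_spread_def pg_subspaces_eq[OF assms(1)] by blast
  then obtain f where f: "\<forall>s\<in>S. s = pg_points_in (f s) \<and> vec.subspace (f s) \<and> vec.dim (f s) = t"
    by metis
  have "spread_family t (f ` S)"
    unfolding spread_family_def
  proof (intro conjI ballI pairwiseI)
    fix U assume "U \<in> f ` S"
    then show "vec.subspace U" "vec.dim U = t" using f by auto
  next
    fix U V assume "U \<in> f ` S" "V \<in> f ` S" "U \<noteq> V"
    then obtain s s' where s: "s \<in> S" "s' \<in> S" "s \<noteq> s'" "U = f s" "V = f s'" by blast
    then have "disjnt s s'"
      using S by (simp add: partial_spread_def pairwise_def)
    then have "disjnt (pg_points_in (f s)) (pg_points_in (f s'))"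
      using f s(1,2) by metis
    then show "U \<inter> V = {0}"
      using disjnt_pg_points_in_iff f s by metis
  qed
  moreover have "card (f ` S) = card S"
    using f by (intro card_image inj_onI) metis
  ultimately show ?thesis using that by blast
qed

section \<open>Combining the two bounds into the exact value\<close>

theorem theorem1p5:
  fixes n t q r :: nat
  assumes "CARD('a::{field,finite}) = q"
    and "CARD('n::finite) = n"
    and "0 < t" and "t < n"
    and "r = n mod t"
    and "real t > (real q ^ r - 1) / (real q - 1)"
  shows "real (max_partial_spread TYPE('a ^ 'n) t)
           = (real q ^ n - real q ^ (t + r)) / (real q ^ t - 1) + 1"
proof -
  have q: "q \<ge> 2" using CARD_field_ge_2[where 'a = 'a] assms(1) by simp
  \<comment> \<open>The geometric sum makes the quotient in the hypothesis a natural number.\<close>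
  define m where "m = (\<Sum>j<r. q ^ j)"
  have m: "int m * (int q - 1) = int q ^ r - 1"
    by (simp add: m_def power_diff_1_eq mult.commute)
  have "real m * (real q - 1) = real q ^ r - 1"
    by (simp add: m_def power_diff_1_eq mult.commute)
  then have "real m = (real q ^ r - 1) / (real q - 1)"
    using q by (simp add: field_simps)
  then have mt: "m < t" using assms(6) by simp
  have "n div t > 0"
    using assms(3,4) by (simp add: div_greater_zero_iff)
  then obtain k where k: "n div t = k + 1"
    by (metis Suc_eq_plus1 gr0_conv_Suc)
  have "n = (k + 1) * t + r"
    unfolding k[symmetric] assms(5) by simp
  then have "vec.dim (UNIV :: ('a ^ 'n) set) = (k + 1) * t + r"
    using assms(2) vec_dim_card by metis
  then obtain T :: "('a ^ 'n) set set" where T: "spread_family t T"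
    and cardT: "int (card T) * (int q ^ t - 1) = int q ^ n - int q ^ (t + r) + (int q ^ t - 1)"
    using ex_spread_family[OF assms(3) vec.subspace_UNIV] assms(1,2) vec_dim_card by metis
  have "max_partial_spread TYPE('a ^ 'n) t = card T"
    unfolding max_partial_spread_def
  proof (rule Max_eqI)
    show "finite (card ` {S :: ('a ^ 'n) set set set. partial_spread (t - 1) S})"
      by (rule partial_spread_cards_finite)
    show "card T \<in> card ` {S :: ('a ^ 'n) set set set. partial_spread (t - 1) S}"
      using partial_spread_of_spread_family[OF assms(3) T] card_image
      by (metis (mono_tags, lifting) imageI mem_Collect_eq)
    fix y assume "y \<in> card ` {S :: ('a ^ 'n) set set set. partial_spread (t - 1) S}"
    then obtain S :: "('a ^ 'n) set set set" where S: "partial_spread (t - 1) S" "y = card S"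
      by blast
    show "y \<le> card T"
    proof (rule ccontr)
      assume "\<not> y \<le> card T"
      \<comment> \<open>Cutting a larger spread down to exactly one extra member yields the precise
        size that \<open>no_oversized_spread_family\<close> excludes.\<close>
      then obtain S' where S': "S' \<subseteq> S" "card S' = card T + 1"
        using S(2) obtain_subset_with_card_n[of "card T + 1" S] by auto
      have "partial_spread (t - 1) S'"
        using S(1) S'(1) by (auto simp: partial_spread_def intro: pairwise_subset)
      then obtain T' :: "('a ^ 'n) set set" where T': "spread_family t T'" "card T' = card T + 1"
        using spread_family_of_partial_spread[OF assms(3)] S'(2) by metis
      have "int (card T') * (int q ^ t - 1) = int q ^ n - int q ^ (t + r) + 2 * (int q ^ t - 1)"
        using cardT by (simp add: T'(2) algebra_simps)
      then show False
        using no_oversized_spread_family[OF T'(1) assms(3), of m r] m mt assms(1,2,4) by simp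
    qed
  qed
  moreover have "real (card T) = (real q ^ n - real q ^ (t + r)) / (real q ^ t - 1) + 1"
  proof -
    have "real_of_int (int (card T) * (int q ^ t - 1))
        = real_of_int (int q ^ n - int q ^ (t + r) + (int q ^ t - 1))"
      by (simp only: cardT)
    then have "real (card T) * (real q ^ t - 1) = real q ^ n - real q ^ (t + r) + (real q ^ t - 1)"
      by simp
    moreover have "real q ^ t > 1"
      using q assms(3) by (intro one_less_power) auto
    ultimately show ?thesis by (simp add: field_simps)
  qed
  ultimately show ?thesis by simp
qed

end
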